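(* Let $\theta>1$, $\tilde C>0$ and let $\ell:V\to\{1,\dots,|V|\}$ be a bijection such that $$G_{ij}\le\frac{\tilde C}{(1+|\ell(i)-\ell(j)|)^\theta}\quad\text{for all }i,j\in V.$$ There is a constant $\tilde C_1>0$, depending only on $\tilde C,\bar\lambda,\theta,\zeta$, such that with $s_n=(n/\log|V_O|)^{1/(2\theta)}$ the matrix $\bar W\in\mathbb R^{V_O\times V_O}$ given by $\bar W_{ij}=(H^{-1})_{ij}$ if $|\ell(i)-\ell(j)|\le\frac{s_n-1}2$ and $\bar W_{ij}=0$ otherwise is an $(s_n,r_{1n})$-sparse approximation of $H^{-1}$ with $$r_{1n}\le\frac{\tilde C_12^\theta}{\theta-1}\Big(\frac{\log|V_O|}n\Big)^{(\theta-1)/(2\theta)} .$$ (Here $\tilde C_1$ is a constant such that $\max\{|(M^{-1})_{ij}|,|(H^{-1})_{ij}|\}\le\tilde C_1/(1+|\ell(i)-\ell(j)|)^\theta$ for all indices for which the entries are defined.)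
   Context: $V=V_O\sqcup V_L$ is a finite set of agents (observable and latent), $|V_O|\ge2$, $n\ge1$ an integer, $G\in\mathbb R_{\ge0}^{V\times V}$ is the weight matrix, $\Lambda=\mathrm{diag}(\lambda_i)_{i\in V}$ with $0<\lambda_i\le\bar\lambda$, $M=\Lambda-G$, with blocks $M_{OO},M_{OL},M_{LO},M_{LL}$ corresponding to $V_O,V_L$, and $H=M_{OO}-M_{OL}M_{LL}^{-1}M_{LO}$ (indexed by $V_O\times V_O$). Standing assumption (diagonal dominance): there is $\zeta>0$ with $\lambda_i\ge\sum_jG_{ij}+\zeta$ and $\lambda_i\ge\sum_jG_{ji}+\zeta$ for all $i\in V$. A matrix is $s$-sparse if each row and each column has at most $s$ nonzero entries. $\bar W$ is an $(s,r_1)$-sparse approximation of $H^{-1}$ if $\bar W$ is $s$-sparse and $\max\{\|H^{-1}-\bar W\|_1,\|H^{-1}-\bar W\|_\infty\}\le r_1$, where $\|\cdot\|_1,\|\cdot\|_\infty$ are the maximum absolute column and row sums. *)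

theory Defs
  imports Complex_Main "Jordan_Normal_Form.Gauss_Jordan_Elimination"
begin

text \<open>
  Agents are the indices \<open>0, \<dots>, p + q - 1\<close>, listed with the \<open>p\<close> observable agents first and the
  \<open>q\<close> latent agents last (\<open>q = 0\<close> is allowed).  Hence the four blocks of a matrix \<open>M\<close> over all
  agents are those of \<open>split_block M p p\<close>, and index \<open>i < p\<close> of a matrix over the observable
  agents denotes the same agent as index \<open>i\<close> of \<open>M\<close>.
\<close>

text \<open>Unspecified if \<open>A\<close> is not invertible.\<close>

definition inv_mat :: "real mat \<Rightarrow> real mat" where
  "inv_mat A = the (mat_inverse A)"

definition latent_block :: "nat \<Rightarrow> real mat \<Rightarrow> real mat" where
  "latent_block p M = (case split_block M p p of (M_OO, M_OL, M_LO, M_LL) \<Rightarrow> M_LL)"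

definition schur_mat :: "nat \<Rightarrow> real mat \<Rightarrow> real mat" where
  "schur_mat p M =
     (case split_block M p p of (M_OO, M_OL, M_LO, M_LL) \<Rightarrow> M_OO - M_OL * inv_mat M_LL * M_LO)"

definition diag_dominant :: "nat \<Rightarrow> (nat \<Rightarrow> real) \<Rightarrow> real mat \<Rightarrow> real \<Rightarrow> bool" where
  "diag_dominant N lam G \<zeta> \<longleftrightarrow>
     (\<forall>i<N. lam i \<ge> (\<Sum>j<N. G $$ (i, j)) + \<zeta> \<and> lam i \<ge> (\<Sum>j<N. G $$ (j, i)) + \<zeta>)"

text \<open>Maximum absolute column and row sums; meaningful for matrices without empty dimension.\<close>

definition norm_1_mat :: "real mat \<Rightarrow> real" where
  "norm_1_mat A = Max ((\<lambda>j. \<Sum>i<dim_row A. \<bar>A $$ (i, j)\<bar>) ` {..<dim_col A})"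

definition norm_inf_mat :: "real mat \<Rightarrow> real" where
  "norm_inf_mat A = Max ((\<lambda>i. \<Sum>j<dim_col A. \<bar>A $$ (i, j)\<bar>) ` {..<dim_row A})"

definition sparse_mat :: "real \<Rightarrow> real mat \<Rightarrow> bool" where
  "sparse_mat s A \<longleftrightarrow>
     (\<forall>i<dim_row A. real (card {j. j < dim_col A \<and> A $$ (i, j) \<noteq> 0}) \<le> s) \<and>
     (\<forall>j<dim_col A. real (card {i. i < dim_row A \<and> A $$ (i, j) \<noteq> 0}) \<le> s)"

text \<open>\<open>W\<close> is an \<open>(s, r)\<close>-sparse approximation of the matrix \<open>K\<close>.\<close>

definition sparse_approximation :: "real \<Rightarrow> real \<Rightarrow> real mat \<Rightarrow> real mat \<Rightarrow> bool" where
  "sparse_approximation s r W K \<longleftrightarrow>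
     W \<in> carrier_mat (dim_row K) (dim_col K) \<and> sparse_mat s W \<and>
     max (norm_1_mat (K - W)) (norm_inf_mat (K - W)) \<le> r"

definition label_dist :: "(nat \<Rightarrow> nat) \<Rightarrow> nat \<Rightarrow> nat \<Rightarrow> real" where
  "label_dist l i j = \<bar>real (l i) - real (l j)\<bar>"

definition band_truncation :: "(nat \<Rightarrow> nat) \<Rightarrow> real \<Rightarrow> real mat \<Rightarrow> real mat" where
  "band_truncation l s K =
     mat (dim_row K) (dim_col K)
       (\<lambda>(i, j). if label_dist l i j \<le> (s - 1) / 2 then K $$ (i, j) else 0)"

end

theory Submission
  imports Defs "Jordan_Normal_Form.Determinant"
begin

text \<open>
  A column \<open>f\<close> of \<open>M\<^sup>-\<^sup>1\<close> solves \<open>\<lambda>\<^sub>i f\<^sub>i = \<delta>\<^sub>i\<^sub>j + \<Sum>\<^sub>k G\<^sub>i\<^sub>k f\<^sub>k\<close>.  Row dominance gives a minimum principle, hence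
  invertibility and \<open>f \<ge> 0\<close>; column dominance gives \<open>\<Sum>\<^sub>k f\<^sub>k \<le> 1 / \<zeta>\<close>.  The decay rate is obtained by
  looking at the index \<open>m\<close> maximising \<open>(1 + d m j) powr \<theta> * f m\<close>: terms \<open>k\<close> with
  \<open>1 + d k j \<ge> \<rho> * (1 + d m j)\<close> inflate this maximum by a factor which, for \<open>\<rho>\<close> close to \<open>1\<close>, is absorbed by
  half of the gap \<open>\<zeta>\<close>, and all other \<open>k\<close> are so far from \<open>m\<close> that the decay of \<open>G\<close> and the bound on the
  mass of \<open>f\<close> suffice.  Finally \<open>H\<^sup>-\<^sup>1\<close> is the observable block of \<open>M\<^sup>-\<^sup>1\<close>.
\<close>


section \<open>Positivity and decay for dominant linear systems\<close>

text \<open>If the minimum \<open>f m\<close> were negative, replacing every \<open>f k\<close> in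
  row \<open>m\<close> by \<open>f m\<close> would force \<open>\<zeta> * f m \<ge> 0\<close>. The
  one-sided hypothesis \<open>super\<close> covers columns of an inverse as well as a kernel vector
  \<open>v\<close> together with \<open>- v\<close>.\<close>

lemma dominant_minimum_principle:
  fixes g :: "nat \<Rightarrow> nat \<Rightarrow> real"
  assumes zeta: "\<zeta> > 0"
    and g_nonneg: "\<And>i k. i < N \<Longrightarrow> k < N \<Longrightarrow> g i k \<ge> 0"
    and row: "\<And>i. i < N \<Longrightarrow> (\<Sum>k<N. g i k) + \<zeta> \<le> lam i"
    and super: "\<And>i. i < N \<Longrightarrow> (\<Sum>k<N. g i k * f k) \<le> lam i * f i"
    and "i < N"
  shows "f i \<ge> 0"
proof (rule ccontr)
  assume neg: "\<not> f i \<ge> 0"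
  obtain m where m: "m < N" "\<And>k. k < N \<Longrightarrow> f m \<le> f k"
    using ex_is_arg_min_if_finite[of "{..<N}" f] \<open>i < N\<close>
    by (auto simp: is_arg_min_linorder)
  have fm: "f m < 0"
    using m(2)[OF \<open>i < N\<close>] neg by simp
  have "(lam m - \<zeta>) * f m \<le> (\<Sum>k<N. g m k) * f m"
    using row[OF m(1)] fm by (intro mult_right_mono_neg) auto
  also have "\<dots> \<le> (\<Sum>k<N. g m k * f k)"
    unfolding sum_distrib_right using m g_nonneg by (intro sum_mono mult_left_mono) auto
  also have "\<dots> \<le> lam m * f m"
    by (rule super[OF m(1)])
  finally have "\<zeta> * f m \<ge> 0"
    by (simp add: algebra_simps)
  with zeta fm show False
    by (simp add: zero_le_mult_iff)
qed

text \<open>The bound is free of \<open>N\<close>, which makes the final constant uniform over all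
  networks. The parameter \<open>\<rho>\<close> separates near from far indices; hypothesis
  \<open>rho\<close> says that trading the weight of \<open>m\<close> for that of a near
  \<open>k\<close> costs at most the factor \<open>1 + \<zeta> / (2 * b)\<close>.\<close>

lemma dominant_solution_decay:
  fixes g D :: "nat \<Rightarrow> nat \<Rightarrow> real"
  assumes pos: "\<zeta> > 0" "C > 0" "\<theta> > 0" "0 < \<rho>" "\<rho> < 1" "b > 0"
    and rho: "1 \<le> (1 + \<zeta> / (2 * b)) * \<rho> powr \<theta>"
    and g_nonneg: "\<And>i k. i < N \<Longrightarrow> k < N \<Longrightarrow> g i k \<ge> 0"
    and row: "\<And>i. i < N \<Longrightarrow> (\<Sum>k<N. g i k) + \<zeta> \<le> lam i"
    and col: "\<And>k. k < N \<Longrightarrow> (\<Sum>i<N. g i k) + \<zeta> \<le> lam k"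
    and lam: "\<And>i. i < N \<Longrightarrow> lam i \<le> b"
    and D_nonneg: "\<And>i k. D i k \<ge> 0"
    and D_triangle: "\<And>i k j. D i j \<le> D i k + D k j"
    and D_refl: "D j j = 0"
    and g_decay: "\<And>i k. i < N \<Longrightarrow> k < N \<Longrightarrow> g i k \<le> C / (1 + D i k) powr \<theta>"
    and sol: "\<And>i. i < N \<Longrightarrow> lam i * f i - (\<Sum>k<N. g i k * f k) = of_bool (i = j)"
    and "i < N" "j < N"
  shows "\<bar>f i\<bar> \<le> 2 / \<zeta> * (1 + C / ((1 - \<rho>) powr \<theta> * \<zeta>)) / (1 + D i j) powr \<theta>"
proof -
  define w where "w k = (1 + D k j) powr \<theta>" for k
  have w_pos: "w k > 0" for k
    unfolding w_def using D_nonneg[of k j] by simp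
  define Q where "Q = C / (1 - \<rho>) powr \<theta>"
  have Q_pos: "Q > 0"
    using pos by (simp add: Q_def)
  have f_nonneg: "f k \<ge> 0" if "k < N" for k
  proof (rule dominant_minimum_principle[OF pos(1) g_nonneg row _ that])
    show "(\<Sum>k<N. g i k * f k) \<le> lam i * f i" if "i < N" for i
      using sol[OF that] by (auto split: if_splits simp: of_bool_def)
  qed
  \<comment> \<open>Adding all equations leaves 1 on the right and, after exchanging the sums, the
    column gaps \<open>lam k - (\<Sum>i<N. g i k) \<ge> \<zeta>\<close> as coefficients of
    \<open>f k\<close>.\<close>
  have mass: "\<zeta> * (\<Sum>k<N. f k) \<le> 1"
  proof -
    have "(\<Sum>i<N. lam i * f i) - (\<Sum>i<N. \<Sum>k<N. g i k * f k) = (\<Sum>i<N. of_bool (i = j))"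
      using sol by (simp add: sum_subtractf[symmetric])
    also have "\<dots> = 1"
      using \<open>j < N\<close> by (simp add: of_bool_def)
    also have "(\<Sum>i<N. \<Sum>k<N. g i k * f k) = (\<Sum>k<N. (\<Sum>i<N. g i k) * f k)"
      by (subst sum.swap) (simp add: sum_distrib_right)
    finally have "1 = (\<Sum>k<N. (lam k - (\<Sum>i<N. g i k)) * f k)"
      by (simp add: sum_subtractf left_diff_distrib)
    also have "\<dots> \<ge> (\<Sum>k<N. \<zeta> * f k)"
      using col f_nonneg by (intro sum_mono mult_right_mono) (auto simp: le_diff_eq add.commute)
    finally show ?thesis
      by (simp add: sum_distrib_left)
  qed
  obtain m where m: "m < N" "\<And>k. k < N \<Longrightarrow> w k * f k \<le> w m * f m"
    using ex_is_arg_min_if_finite[of "{..<N}" "\<lambda>k. - (w k * f k)"] \<open>i < N\<close>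
    by (auto simp: is_arg_min_linorder)
  define T where "T = w m * f m"
  have T_nonneg: "T \<ge> 0"
    unfolding T_def using f_nonneg[OF m(1)] w_pos[of m] by simp
  \<comment> \<open>Both summands on the right are nonnegative, so each case only has to reach one
    of them and the sum over \<open>k\<close> never needs to be cut into near and far
    indices.\<close>
  have split: "w m * (g m k * f k) \<le> (1 + \<zeta> / (2 * b)) * T * g m k + Q * f k" if k: "k < N" for k
  proof (cases "\<rho> * (1 + D m j) \<le> 1 + D k j")
    case True
    have "w m \<le> (1 + \<zeta> / (2 * b)) * \<rho> powr \<theta> * w m"
      using rho w_pos[of m] by simp
    also have "\<dots> = (1 + \<zeta> / (2 * b)) * (\<rho> * (1 + D m j)) powr \<theta>"
      unfolding w_def using pos D_nonneg[of m j] by (simp add: powr_mult)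
    also have "\<dots> \<le> (1 + \<zeta> / (2 * b)) * w k"
      unfolding w_def using True pos D_nonneg[of m j]
      by (intro mult_left_mono powr_mono2) auto
    finally have "w m * (g m k * f k) \<le> (1 + \<zeta> / (2 * b)) * w k * (g m k * f k)"
      using g_nonneg[OF m(1) k] f_nonneg[OF k] by (intro mult_right_mono) auto
    also have "\<dots> = (1 + \<zeta> / (2 * b)) * g m k * (w k * f k)"
      by simp
    also have "\<dots> \<le> (1 + \<zeta> / (2 * b)) * g m k * T"
      unfolding T_def using m(2)[OF k] g_nonneg[OF m(1) k] pos by (intro mult_left_mono) auto
    finally show ?thesis
      using mult_nonneg_nonneg[OF less_imp_le[OF Q_pos] f_nonneg[OF k]] by (simp add: ac_simps)
  next
    case False
    \<comment> \<open>As \<open>k\<close> is much closer to \<open>j\<close> than \<open>m\<close>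
      is, the triangle inequality makes \<open>m\<close> and \<open>k\<close> far apart, on the
      scale of \<open>1 + D m j\<close>; the decay of \<open>g m k\<close> then cancels the weight
      \<open>w m\<close>.\<close>
    then have far: "(1 - \<rho>) * (1 + D m j) \<le> 1 + D m k"
      using D_triangle[of m j k] by (simp add: algebra_simps)
    have "w m * g m k \<le> w m * (C / (1 + D m k) powr \<theta>)"
      using g_decay[OF m(1) k] w_pos[of m] by (intro mult_left_mono) auto
    also have "\<dots> \<le> w m * (C / ((1 - \<rho>) * (1 + D m j)) powr \<theta>)"
      using far w_pos[of m] pos D_nonneg[of m j]
      using D_nonneg[of m k]
      by (intro mult_left_mono divide_left_mono powr_mono2 mult_pos_pos) auto
    also have "\<dots> = Q"
      unfolding w_def Q_def using pos D_nonneg[of m j] by (simp add: powr_mult)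
    finally have "w m * g m k * f k \<le> Q * f k"
      using f_nonneg[OF k] by (intro mult_right_mono)
    moreover have "0 \<le> (1 + \<zeta> / (2 * b)) * T * g m k"
      using pos T_nonneg g_nonneg[OF m(1) k] by simp
    ultimately show ?thesis
      by (simp add: ac_simps)
  qed
  have "lam m * T = w m * (lam m * f m)"
    by (simp add: T_def)
  also have "lam m * f m = of_bool (m = j) + (\<Sum>k<N. g m k * f k)"
    using sol[OF m(1)] by linarith
  also have "w m * \<dots> = w m * of_bool (m = j) + (\<Sum>k<N. w m * (g m k * f k))"
    by (simp add: sum_distrib_left distrib_left)
  \<comment> \<open>The source term sits at \<open>j\<close>, where the weight \<open>w j\<close> is
    1 because \<open>D j j = 0\<close>.\<close>
  also have "\<dots> \<le> 1 + (\<Sum>k<N. (1 + \<zeta> / (2 * b)) * T * g m k + Q * f k)"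
    using split D_refl by (intro add_mono sum_mono) (auto simp: w_def)
  also have "\<dots> = 1 + (1 + \<zeta> / (2 * b)) * T * (\<Sum>k<N. g m k) + Q * (\<Sum>k<N. f k)"
    by (simp add: sum.distrib sum_distrib_left)
  also have "\<dots> \<le> 1 + (1 + \<zeta> / (2 * b)) * T * (lam m - \<zeta>) + Q * (1 / \<zeta>)"
    using row[OF m(1)] mass T_nonneg Q_pos pos
    by (intro add_mono mult_left_mono order_refl) (auto simp: field_simps)
  also have "\<dots> \<le> 1 + (lam m - \<zeta> / 2) * T + Q / \<zeta>"
  proof -
    \<comment> \<open>Since \<open>lam m \<le> b\<close>, the inflation factor consumes at most
      \<open>\<zeta> / 2\<close> of the gap; the remaining half bounds \<open>T\<close>.\<close>
    have "\<zeta> / (2 * b) * (lam m - \<zeta>) \<le> \<zeta> / (2 * b) * b"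
      using lam[OF m(1)] pos by (intro mult_left_mono) auto
    then have "(1 + \<zeta> / (2 * b)) * (lam m - \<zeta>) \<le> lam m - \<zeta> / 2"
      using pos by (simp add: algebra_simps)
    from mult_right_mono[OF this T_nonneg] show ?thesis
      by (simp add: ac_simps)
  qed
  finally have "T \<le> 2 / \<zeta> * (1 + Q / \<zeta>)"
    using pos by (simp add: field_simps)
  with m(2)[OF \<open>i < N\<close>] have "w i * f i \<le> 2 / \<zeta> * (1 + Q / \<zeta>)"
    by (simp add: T_def)
  then have "f i \<le> 2 / \<zeta> * (1 + Q / \<zeta>) / w i"
    using w_pos[of i] by (subst pos_le_divide_eq) (simp_all add: mult.commute)
  then show ?thesis
    using f_nonneg[OF \<open>i < N\<close>] by (simp add: w_def Q_def)
qed

section \<open>Tail sums and counting in a band of labels\<close>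

text \<open>A discrete integral comparison: each term is dominated by a multiple of the telescoping
  difference \<open>h k - h (Suc k)\<close>. The factor \<open>2 powr \<theta>\<close> pays for
  comparing a term with a value of the integrand to its right.\<close>

lemma powr_tail_sum:
  fixes \<theta> u :: real and A :: "nat set"
  assumes "\<theta> > 1" "u > 0" "finite A" and u: "\<And>k. k \<in> A \<Longrightarrow> u \<le> 1 + real k"
  shows "(\<Sum>k\<in>A. 1 / (1 + real k) powr \<theta>) \<le> 2 powr \<theta> / (\<theta> - 1) * u powr (1 - \<theta>)"
proof (cases "A = {}")
  case True
  then show ?thesis using assms by simp
next
  case False
  define h where "h k = (1 + real k) powr (1 - \<theta>)" for k
  have step: "1 / (1 + real k) powr \<theta> \<le> 2 powr \<theta> / (\<theta> - 1) * (h k - h (Suc k))" for k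
  proof -
    \<comment> \<open>The intermediate point satisfies
      \<open>z < 2 + real k \<le> 2 * (1 + real k)\<close>, which is where the 2 comes from.\<close>
    have "\<exists>z>1 + real k. z < 2 + real k \<and>
        (2 + real k) powr (1 - \<theta>) - (1 + real k) powr (1 - \<theta>)
        = (2 + real k - (1 + real k)) * ((1 - \<theta>) * z powr (1 - \<theta> - 1))"
      by (rule MVT2) (auto intro!: derivative_eq_intros)
    then obtain z where z: "1 + real k < z" "z < 2 + real k"
      and eq: "h k - h (Suc k) = (\<theta> - 1) * z powr - \<theta>"
      by (auto simp: h_def algebra_simps)
    have "1 / (1 + real k) powr \<theta> = 2 powr \<theta> * (2 * (1 + real k)) powr - \<theta>"
      by (subst powr_mult) (auto simp: powr_minus_divide)
    also have "\<dots> \<le> 2 powr \<theta> * z powr - \<theta>"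
      using z assms by (intro mult_left_mono powr_mono2') auto
    finally show ?thesis
      using eq assms by simp
  qed
  have telescope: "(\<Sum>k=m..<n. h k - h (Suc k)) = h m - h n" if "m \<le> n" for m n
    using sum_Suc_diff'[OF that, of "\<lambda>k. - h k"] by simp
  \<comment> \<open>Enlarging \<open>A\<close> to the full interval between its extremes lets the
    sum telescope.\<close>
  let ?a = "Min A" and ?b = "Suc (Max A)"
  have "(\<Sum>k\<in>A. 1 / (1 + real k) powr \<theta>) \<le> (\<Sum>k\<in>{?a..<?b}. 1 / (1 + real k) powr \<theta>)"
    using assms by (intro sum_mono2) (auto simp: less_Suc_eq_le)
  also have "\<dots> \<le> (\<Sum>k\<in>{?a..<?b}. 2 powr \<theta> / (\<theta> - 1) * (h k - h (Suc k)))"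
    by (intro sum_mono step)
  also have "\<dots> = 2 powr \<theta> / (\<theta> - 1) * (h ?a - h ?b)"
  proof -
    have "?a \<le> ?b"
      using assms False by (metis Max_ge Min_in le_Suc_eq)
    then show ?thesis
      by (simp only: sum_distrib_left[symmetric] telescope)
  qed
  also have "\<dots> \<le> 2 powr \<theta> / (\<theta> - 1) * h ?a"
    using assms by (intro mult_left_mono) (auto simp: h_def)
  also have "\<dots> \<le> 2 powr \<theta> / (\<theta> - 1) * u powr (1 - \<theta>)"
    unfolding h_def using assms False u[OF Min_in[OF assms(3) False]]
    by (intro mult_left_mono powr_mono2') auto
  finally show ?thesis .
qed

lemma label_dist_commute: "label_dist l i j = label_dist l j i"
  by (simp add: label_dist_def abs_minus_commute)

text \<open>The labels on either side of \<open>l i\<close> have pairwise distinct natural distances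
  from it, because \<open>l\<close> is injective. Each side is thus a tail sum over naturals, and
  the two sides give the factor 2.\<close>

lemma label_dist_tail_sum:
  assumes "\<theta> > 1" "u > 0" "finite J" "inj_on l J"
    and u: "\<And>j. j \<in> J \<Longrightarrow> u \<le> 1 + label_dist l i j"
  shows "(\<Sum>j\<in>J. 1 / (1 + label_dist l i j) powr \<theta>)
    \<le> 2 * (2 powr \<theta> / (\<theta> - 1) * u powr (1 - \<theta>))"
proof -
  have side: "(\<Sum>j\<in>A. 1 / (1 + label_dist l i j) powr \<theta>) \<le> 2 powr \<theta> / (\<theta> - 1) * u powr (1 - \<theta>)"
    if "A \<subseteq> J" and k: "inj_on k A" "\<And>j. j \<in> A \<Longrightarrow> label_dist l i j = real (k j)" for A and k :: "nat \<Rightarrow> nat"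
  proof -
    have "(\<Sum>j\<in>A. 1 / (1 + label_dist l i j) powr \<theta>) = (\<Sum>n\<in>k ` A. 1 / (1 + real n) powr \<theta>)"
      using k by (simp add: sum.reindex)
    also have "\<dots> \<le> 2 powr \<theta> / (\<theta> - 1) * u powr (1 - \<theta>)"
    proof (rule powr_tail_sum[OF assms(1,2)])
      show "finite (k ` A)"
        using assms(3) \<open>A \<subseteq> J\<close> by (auto intro: finite_subset)
      show "u \<le> 1 + real n" if n: "n \<in> k ` A" for n
      proof -
        obtain j where "j \<in> A" "n = k j"
          using n by auto
        with u[of j] k(2)[of j] \<open>A \<subseteq> J\<close> show ?thesis
          by auto
      qed
    qed
    finally show ?thesis .
  qed
  have "(\<Sum>j\<in>J. 1 / (1 + label_dist l i j) powr \<theta>)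
    = (\<Sum>j\<in>{j \<in> J. l i \<le> l j} \<union> {j \<in> J. l j < l i}. 1 / (1 + label_dist l i j) powr \<theta>)"
    by (rule sum.cong) auto
  also have "\<dots> = (\<Sum>j\<in>{j \<in> J. l i \<le> l j}. 1 / (1 + label_dist l i j) powr \<theta>)
    + (\<Sum>j\<in>{j \<in> J. l j < l i}. 1 / (1 + label_dist l i j) powr \<theta>)"
    using assms(3) by (intro sum.union_disjoint) auto
  also have "(\<Sum>j\<in>{j \<in> J. l i \<le> l j}. 1 / (1 + label_dist l i j) powr \<theta>)
      \<le> 2 powr \<theta> / (\<theta> - 1) * u powr (1 - \<theta>)"
    using assms(4) by (intro side[where k = "\<lambda>j. l j - l i"])
      (auto simp: label_dist_def of_nat_diff inj_on_def eq_diff_iff)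
  also have "(\<Sum>j\<in>{j \<in> J. l j < l i}. 1 / (1 + label_dist l i j) powr \<theta>)
      \<le> 2 powr \<theta> / (\<theta> - 1) * u powr (1 - \<theta>)"
    using assms(4) by (intro side[where k = "\<lambda>j. l i - l j"])
      (auto simp: label_dist_def of_nat_diff inj_on_def)
  finally show ?thesis
    by (simp only: mult_2)
qed

text \<open>Labels are integers, so the half-width \<open>(s - 1) / 2\<close> can be rounded down to
  \<open>t\<close>, leaving at most \<open>2 * t + 1 \<le> s\<close> labels. For
  \<open>s < 1\<close> one has \<open>t = -1\<close>: the interval is empty and
  \<open>nat (2 * t + 1)\<close> is 0.\<close>

lemma card_band_le:
  assumes "inj_on l J" "s > 0"
  shows "real (card {j \<in> J. label_dist l i j \<le> (s - 1) / 2}) \<le> s"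
proof -
  define A where "A = {j \<in> J. label_dist l i j \<le> (s - 1) / 2}"
  define t where "t = \<lfloor>(s - 1) / 2\<rfloor>"
  have sub: "(\<lambda>j. int (l j)) ` A \<subseteq> {int (l i) - t..int (l i) + t}"
  proof safe
    fix j assume "j \<in> A"
    then have "\<bar>int (l i) - int (l j)\<bar> \<le> t"
      unfolding A_def label_dist_def t_def le_floor_iff by simp
    then show "int (l j) \<in> {int (l i) - t..int (l i) + t}"
      by auto
  qed
  have "card A = card ((\<lambda>j. int (l j)) ` A)"
    using assms by (intro card_image[symmetric]) (auto simp: A_def inj_on_def)
  also have "\<dots> \<le> nat (2 * t + 1)"
    using card_mono[OF _ sub] by (simp add: algebra_simps)
  also have "real \<dots> \<le> s"
    using assms of_int_floor_le[of "(s - 1) / 2"] unfolding t_def by (simp add: field_simps)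
  finally show ?thesis
    unfolding A_def by simp
qed

section \<open>Inverses of dominant matrices and of the Schur complement\<close>

lemma inv_mat_inverse:
  assumes A: "A \<in> carrier_mat n n" and det: "det A \<noteq> 0"
  shows "inv_mat A \<in> carrier_mat n n" "A * inv_mat A = 1\<^sub>m n" "inv_mat A * A = 1\<^sub>m n"
    "invertible_mat A"
proof -
  \<comment> \<open>Instantiating with \<open>()\<close> makes both facts speak of the units of the
    same matrix ring record.\<close>
  have "mat_inverse A \<noteq> None"
    using mat_inverse(1)[OF A, of "()"] det_non_zero_imp_unit[OF A det, of "()"] by blast
  then have inv: "mat_inverse A = Some (inv_mat A)"
    by (auto simp: inv_mat_def)
  show *: "inv_mat A \<in> carrier_mat n n" "A * inv_mat A = 1\<^sub>m n" "inv_mat A * A = 1\<^sub>m n"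
    using mat_inverse(2)[OF A inv] by auto
  show "invertible_mat A"
    unfolding invertible_mat_def inverts_mat_def using * A by auto
qed

text \<open>Determinants turn the one-sided identity into invertibility, so a single product
  identifies the inverse.\<close>

lemma inv_mat_unique:
  assumes A: "A \<in> carrier_mat n n" and B: "B \<in> carrier_mat n n" and AB: "A * B = 1\<^sub>m n"
  shows "invertible_mat A" "inv_mat A = B"
proof -
  have "det A \<noteq> 0"
    using det_mult[OF A B] AB by auto
  note inv = inv_mat_inverse[OF A this]
  show "invertible_mat A"
    by (rule inv)
  have "inv_mat A = inv_mat A * (A * B)"
    using AB inv(1) by simp
  also have "\<dots> = inv_mat A * A * B"
    using inv A B by (intro assoc_mult_mat[symmetric]) auto
  also have "\<dots> = B"
    using inv(3) B by simp
  finally show "inv_mat A = B" .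
qed

text \<open>For a kernel vector \<open>v\<close> the rows hold with equality, so the minimum
  principle applies to \<open>v\<close> and to \<open>- v\<close> and forces \<open>v\<close> to
  vanish. With \<open>g\<close> and \<open>lam\<close> as functions it fits both \<open>M\<close>
  and its latent block.\<close>

lemma dominant_mat_det_nonzero:
  fixes A :: "real mat"
  assumes A: "A \<in> carrier_mat N N" and zeta: "\<zeta> > 0"
    and entry: "\<And>i k. i < N \<Longrightarrow> k < N \<Longrightarrow> A $$ (i, k) = (if i = k then lam i else 0) - g i k"
    and g_nonneg: "\<And>i k. i < N \<Longrightarrow> k < N \<Longrightarrow> g i k \<ge> 0"
    and row: "\<And>i. i < N \<Longrightarrow> (\<Sum>k<N. g i k) + \<zeta> \<le> lam i"
  shows "det A \<noteq> 0"
proof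
  assume "det A = 0"
  then obtain v where v: "v \<in> carrier_vec N" "v \<noteq> 0\<^sub>v N" "A *\<^sub>v v = 0\<^sub>v N"
    using det_0_iff_vec_prod_zero_field[OF A] by auto
  have eq: "(\<Sum>k<N. g i k * v $ k) = lam i * v $ i" if "i < N" for i
  proof -
    have "0 = (A *\<^sub>v v) $ i"
      using v that by simp
    also have "\<dots> = (\<Sum>k<N. A $$ (i, k) * v $ k)"
      using A v(1) that by (simp add: scalar_prod_def lessThan_atLeast0)
    also have "\<dots> = (\<Sum>k<N. (if i = k then lam i * v $ k else 0) - g i k * v $ k)"
      using that by (intro sum.cong) (auto simp: entry algebra_simps)
    also have "\<dots> = lam i * v $ i - (\<Sum>k<N. g i k * v $ k)"
      using that by (simp add: sum_subtractf)
    finally show ?thesis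
      by simp
  qed
  have "v $ i = 0" if "i < N" for i
  proof -
    have "v $ i \<ge> 0"
      by (rule dominant_minimum_principle[OF zeta g_nonneg row _ that]) (auto simp: eq)
    moreover have "- (v $ i) \<ge> 0"
      by (rule dominant_minimum_principle[OF zeta g_nonneg row _ that, where f = "\<lambda>i. - (v $ i)"])
        (auto simp: eq sum_negf)
    ultimately show ?thesis
      by simp
  qed
  with v show False
    by auto
qed

text \<open>The left block column of \<open>M * inv_mat M = 1\<close> reads
  \<open>A * X + B * Z = 1\<close> and \<open>C * X + D * Z = 0\<close>. Eliminating
  \<open>Z\<close> shows that the observable block \<open>X\<close> of the inverse is a right
  inverse of the Schur complement, hence its inverse.\<close>

lemma inv_schur_mat:
  assumes M: "M \<in> carrier_mat (p + q) (p + q)" "det M \<noteq> 0" "det (latent_block p M) \<noteq> 0"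
  shows "schur_mat p M \<in> carrier_mat p p" "invertible_mat (schur_mat p M)"
    "\<And>i j. i < p \<Longrightarrow> j < p \<Longrightarrow> inv_mat (schur_mat p M) $$ (i, j) = inv_mat M $$ (i, j)"
    "inv_mat (schur_mat p M) \<in> carrier_mat p p"
proof -
  obtain A B C D where M_split: "split_block M p p = (A, B, C, D)"
    by (cases "split_block M p p") auto
  note blocks = split_block[OF M_split, of q q]
  have c: "A \<in> carrier_mat p p" "B \<in> carrier_mat p q" "C \<in> carrier_mat q p" "D \<in> carrier_mat q q"
    and M_eq: "M = four_block_mat A B C D"
    using blocks M by auto
  have D: "latent_block p M = D" and H: "schur_mat p M = A - B * inv_mat D * C"
    by (simp_all add: latent_block_def schur_mat_def M_split)
  have detD: "det D \<noteq> 0"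
    using M D by simp
  note invD = inv_mat_inverse[OF c(4) detD]
  note invM = inv_mat_inverse[OF M(1,2)]
  obtain X Y Z W where inv_split: "split_block (inv_mat M) p p = (X, Y, Z, W)"
    by (cases "split_block (inv_mat M) p p") auto
  note inv_blocks = split_block[OF inv_split, of q q]
  have d: "X \<in> carrier_mat p p" "Y \<in> carrier_mat p q" "Z \<in> carrier_mat q p" "W \<in> carrier_mat q q"
    and inv_eq: "inv_mat M = four_block_mat X Y Z W"
    using inv_blocks invM(1) by auto
  have prod: "four_block_mat (A * X + B * Z) (A * Y + B * W) (C * X + D * Z) (C * Y + D * W)
      = four_block_mat (1\<^sub>m p) (0\<^sub>m p q) (0\<^sub>m q p) (1\<^sub>m q)"
    using invM(2) mult_four_block_mat[OF c d] by (simp add: M_eq[symmetric] inv_eq[symmetric])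
  have 1: "A * X + B * Z = 1\<^sub>m p"
  proof (rule eq_matI)
    fix i j assume "i < dim_row (1\<^sub>m p :: real mat)" "j < dim_col (1\<^sub>m p :: real mat)"
    then show "(A * X + B * Z) $$ (i, j) = (1\<^sub>m p :: real mat) $$ (i, j)"
      using arg_cong[OF prod, of "\<lambda>K. K $$ (i, j)"] c d by simp
  qed (use c d in auto)
  have 2: "C * X + D * Z = 0\<^sub>m q p"
  proof (rule eq_matI)
    fix i j assume "i < dim_row (0\<^sub>m q p :: real mat)" "j < dim_col (0\<^sub>m q p :: real mat)"
    then show "(C * X + D * Z) $$ (i, j) = (0\<^sub>m q p :: real mat) $$ (i, j)"
      using arg_cong[OF prod, of "\<lambda>K. K $$ (p + i, j)"] c d by simp
  qed (use c d in auto)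
  have "inv_mat D * (D * Z) = inv_mat D * D * Z"
    using c d invD by (intro assoc_mult_mat[symmetric]) auto
  also have "\<dots> = Z"
    using d invD by simp
  finally have "inv_mat D * (C * X) + Z = inv_mat D * (C * X) + inv_mat D * (D * Z)"
    by simp
  also have "\<dots> = inv_mat D * (C * X + D * Z)"
    using c d invD by (intro mult_add_distrib_mat[symmetric]) auto
  also have "\<dots> = 0\<^sub>m q p"
    using invD by (simp add: 2)
  finally have Z: "inv_mat D * (C * X) + Z = 0\<^sub>m q p" .
  have Z': "inv_mat D * (C * X) = - Z"
  proof (rule eq_matI)
    fix i j assume "i < dim_row (- Z)" "j < dim_col (- Z)"
    then show "(inv_mat D * (C * X)) $$ (i, j) = (- Z) $$ (i, j)"
      using arg_cong[OF Z, of "\<lambda>K. K $$ (i, j)"] c d invD by (simp add: add_eq_0_iff2)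
  qed (use c d invD in auto)
  have HX: "schur_mat p M * X = 1\<^sub>m p"
  proof -
    have "schur_mat p M * X = A * X - B * inv_mat D * C * X"
      unfolding H using c d invD by (intro minus_mult_distrib_mat) auto
    also have "B * inv_mat D * C * X = B * (inv_mat D * (C * X))"
    proof -
      have "B * inv_mat D * C * X = B * inv_mat D * (C * X)"
        using c d invD by (intro assoc_mult_mat) auto
      also have "\<dots> = B * (inv_mat D * (C * X))"
        using c d invD by (intro assoc_mult_mat) auto
      finally show ?thesis .
    qed
    also have "\<dots> = - (B * Z)"
      unfolding Z' using c d by (intro uminus_mult_right_mat) auto
    also have "A * X - - (B * Z) = A * X + B * Z"
      using c d by (intro eq_matI) auto
    finally show ?thesis
      using 1 by simp
  qed
  show H_carrier: "schur_mat p M \<in> carrier_mat p p"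
    unfolding H using c invD by (intro minus_carrier_mat) auto
  show "invertible_mat (schur_mat p M)"
    by (rule inv_mat_unique(1)[OF H_carrier d(1) HX])
  have inv_H: "inv_mat (schur_mat p M) = X"
    by (rule inv_mat_unique(2)[OF H_carrier d(1) HX])
  show "inv_mat (schur_mat p M) $$ (i, j) = inv_mat M $$ (i, j)" if "i < p" "j < p" for i j
    using that d by (simp add: inv_H inv_eq)
  show "inv_mat (schur_mat p M) \<in> carrier_mat p p"
    using d inv_H by simp
qed

section \<open>Error of the band truncation\<close>

lemma band_truncation_sparse_approximation:
  assumes K: "K \<in> carrier_mat p p" "p > 0"
    and "\<theta> > 1" "s > 0" "c \<ge> 0"
    and inj: "inj_on l {..<p}"
    and decay: "\<And>i j. i < p \<Longrightarrow> j < p \<Longrightarrow> \<bar>K $$ (i, j)\<bar> \<le> c / (1 + label_dist l i j) powr \<theta>"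
  shows "sparse_approximation s (c * 2 powr \<theta> * 2 powr \<theta> / (\<theta> - 1) * s powr (1 - \<theta>))
    (band_truncation l s K) K"
proof -
  define W where "W = band_truncation l s K"
  have W: "W \<in> carrier_mat p p"
    "\<And>i j. i < p \<Longrightarrow> j < p \<Longrightarrow> W $$ (i, j) = (if label_dist l i j \<le> (s - 1) / 2 then K $$ (i, j) else 0)"
    using K by (auto simp: W_def band_truncation_def)
  have card: "real (card {j. j < p \<and> P j}) \<le> s"
    if "\<And>j. j < p \<Longrightarrow> P j \<Longrightarrow> label_dist l i j \<le> (s - 1) / 2" for P i
  proof -
    have "card {j. j < p \<and> P j} \<le> card {j \<in> {..<p}. label_dist l i j \<le> (s - 1) / 2}"
      using that by (intro card_mono) auto
    with card_band_le[OF inj \<open>s > 0\<close>, of i] show ?thesis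
      by linarith
  qed
  have "sparse_mat s W"
    unfolding sparse_mat_def
  proof (intro conjI allI impI)
    fix i assume "i < dim_row W"
    then show "real (card {j. j < dim_col W \<and> W $$ (i, j) \<noteq> 0}) \<le> s"
      using W card[of "\<lambda>j. W $$ (i, j) \<noteq> 0" i] by (auto split: if_splits)
  next
    fix j assume "j < dim_col W"
    then show "real (card {i. i < dim_row W \<and> W $$ (i, j) \<noteq> 0}) \<le> s"
      using W card[of "\<lambda>i. W $$ (i, j) \<noteq> 0" j] by (auto split: if_splits simp: label_dist_commute)
  qed
  define r where "r = c * 2 powr \<theta> * 2 powr \<theta> / (\<theta> - 1) * s powr (1 - \<theta>)"
  \<comment> \<open>Here \<open>f\<close> stands for a row or a column of \<open>K - W\<close>; as
    \<open>label_dist\<close> is symmetric, one estimate serves both norms.\<close>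
  have line: "(\<Sum>j<p. \<bar>f j\<bar>) \<le> r"
    if f: "\<And>j. j < p \<Longrightarrow> f j = 0 \<or> (s - 1) / 2 < label_dist l i j \<and> \<bar>f j\<bar> \<le> c / (1 + label_dist l i j) powr \<theta>"
    for f i
  proof -
    define J where "J = {j. j < p \<and> (s - 1) / 2 < label_dist l i j}"
    have "(\<Sum>j<p. \<bar>f j\<bar>) = (\<Sum>j\<in>J. \<bar>f j\<bar>)"
      using f by (intro sum.mono_neutral_right) (auto simp: J_def)
    also have "\<dots> \<le> (\<Sum>j\<in>J. c * (1 / (1 + label_dist l i j) powr \<theta>))"
      using f \<open>c \<ge> 0\<close> by (intro sum_mono) (fastforce simp: J_def)
    also have "\<dots> = c * (\<Sum>j\<in>J. 1 / (1 + label_dist l i j) powr \<theta>)"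
      by (simp add: sum_distrib_left)
    \<comment> \<open>Outside the band \<open>1 + label_dist l i j > (s + 1) / 2\<close>, so
      \<open>u = s / 2\<close> is admissible. The 2 from the two sides cancels against
      \<open>(s / 2) powr (1 - \<theta>)\<close>, whose remaining \<open>2 powr \<theta>\<close> is
      the second such factor in \<open>r\<close>.\<close>
    also have "\<dots> \<le> c * (2 * (2 powr \<theta> / (\<theta> - 1) * (s / 2) powr (1 - \<theta>)))"
      using assms by (intro mult_left_mono label_dist_tail_sum)
        (auto simp: J_def field_simps intro: inj_on_subset)
    also have "(s / 2) powr (1 - \<theta>) = s powr (1 - \<theta>) * (2 powr \<theta> / 2)"
      using \<open>s > 0\<close> by (simp add: powr_divide powr_diff)
    finally show ?thesis
      using assms by (simp add: r_def field_simps)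
  qed
  have diff: "(K - W) $$ (i, j) = 0 \<or> (s - 1) / 2 < label_dist l i j
      \<and> \<bar>(K - W) $$ (i, j)\<bar> \<le> c / (1 + label_dist l i j) powr \<theta>" if "i < p" "j < p" for i j
    using that W K decay[OF that] by auto
  have dims: "dim_row (K - W) = p" "dim_col (K - W) = p"
    using K W by auto
  have "norm_1_mat (K - W) \<le> r"
    unfolding norm_1_mat_def dims
  proof (rule Max.boundedI)
    show "x \<le> r" if x: "x \<in> (\<lambda>j. \<Sum>i<p. \<bar>(K - W) $$ (i, j)\<bar>) ` {..<p}" for x
    proof -
      obtain j where "j < p" "x = (\<Sum>i<p. \<bar>(K - W) $$ (i, j)\<bar>)"
        using x by auto
      then show ?thesis
        using line[of "\<lambda>i. (K - W) $$ (i, j)" j] diff[of _ j]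
        by (simp only: label_dist_commute[of l j])
    qed
  qed (use K in auto)
  moreover have "norm_inf_mat (K - W) \<le> r"
    unfolding norm_inf_mat_def dims
  proof (rule Max.boundedI)
    show "x \<le> r" if x: "x \<in> (\<lambda>i. \<Sum>j<p. \<bar>(K - W) $$ (i, j)\<bar>) ` {..<p}" for x
      using x line[of "\<lambda>j. (K - W) $$ (_, j)"] diff by blast
  qed (use K in auto)
  ultimately show ?thesis
    using K W \<open>sparse_mat s W\<close> unfolding sparse_approximation_def W_def r_def by auto
qed

section \<open>Choice of constants and conclusion\<close>

theorem lemma6:
  fixes C lam_bar \<theta> \<zeta> :: real
  assumes "\<theta> > 1" and "C > 0" and "\<zeta> > 0"
  shows "\<exists>C1>0. \<forall>(p::nat) (q::nat) (n::nat) (G::real mat) (lam::nat \<Rightarrow> real) (l::nat \<Rightarrow> nat).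
    p \<ge> 2 \<and> n \<ge> 1 \<and>
    G \<in> carrier_mat (p + q) (p + q) \<and>
    (\<forall>i<p + q. \<forall>j<p + q. G $$ (i, j) \<ge> 0) \<and>
    (\<forall>i<p + q. 0 < lam i \<and> lam i \<le> lam_bar) \<and>
    diag_dominant (p + q) lam G \<zeta> \<and>
    bij_betw l {..<p + q} {1..p + q} \<and>
    (\<forall>i<p + q. \<forall>j<p + q. G $$ (i, j) \<le> C / (1 + label_dist l i j) powr \<theta>)
    \<longrightarrow>
    (let M = mat_diag (p + q) lam - G;
         H = schur_mat p M;
         s = (real n / ln (real p)) powr (1 / (2 * \<theta>));
         W = band_truncation l s (inv_mat H)
     in invertible_mat M \<and> invertible_mat (latent_block p M) \<and> invertible_mat H \<and>
        (\<forall>i<p + q. \<forall>j<p + q. \<bar>inv_mat M $$ (i, j)\<bar> \<le> C1 / (1 + label_dist l i j) powr \<theta>) \<and>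
        (\<forall>i<p. \<forall>j<p. \<bar>inv_mat H $$ (i, j)\<bar> \<le> C1 / (1 + label_dist l i j) powr \<theta>) \<and>
        (\<exists>r. sparse_approximation s r W (inv_mat H) \<and>
             r \<le> C1 * 2 powr \<theta> / (\<theta> - 1) * (ln (real p) / real n) powr ((\<theta> - 1) / (2 * \<theta>))))"
proof -
  \<comment> \<open>The maximum with 1 gives a positive upper bound whatever the sign of
    \<open>lam_bar\<close>. Then \<open>\<rho>\<close> is the solution of
    \<open>(1 + \<zeta> / (2 * b)) * \<rho> powr \<theta> = 1\<close>, and \<open>c\<close> is the
    resulting decay constant; all three are fixed before any matrix.\<close>
  define b where "b = max 1 lam_bar"
  define \<rho> where "\<rho> = (1 + \<zeta> / (2 * b)) powr - (1 / \<theta>)"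
  define c where "c = 2 / \<zeta> * (1 + C / ((1 - \<rho>) powr \<theta> * \<zeta>))"
  have b: "b > 0" "lam_bar \<le> b"
    by (auto simp: b_def)
  have gt1: "1 + \<zeta> / (2 * b) > 1"
    using b assms by simp
  have rho: "0 < \<rho>" "\<rho> < 1" "1 \<le> (1 + \<zeta> / (2 * b)) * \<rho> powr \<theta>"
  proof -
    show "0 < \<rho>"
      using gt1 by (simp add: \<rho>_def)
    show "\<rho> < 1"
      unfolding \<rho>_def using gt1 assms by (subst powr_less_one) auto
    show "1 \<le> (1 + \<zeta> / (2 * b)) * \<rho> powr \<theta>"
      unfolding \<rho>_def powr_powr using gt1 assms by (simp add: powr_minus_divide)
  qed
  have c: "c > 0"
    unfolding c_def using assms rho by (intro mult_pos_pos add_pos_pos divide_pos_pos) auto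
  have c_le: "c \<le> c * 2 powr \<theta>"
    using c assms ge_one_powr_ge_zero[of 2 \<theta>] by simp
  show ?thesis
  \<comment> \<open>The entries already decay with constant \<open>c\<close>; the extra
    \<open>2 powr \<theta>\<close> absorbs the second such factor of the truncation error and only
    weakens the entry bounds.\<close>
  proof (intro exI[of _ "c * 2 powr \<theta>"] conjI allI impI; (elim conjE)?)
    show "c * 2 powr \<theta> > 0"
      using c by simp
  next
    fix p q n :: nat and G :: "real mat" and lam :: "nat \<Rightarrow> real" and l :: "nat \<Rightarrow> nat"
    assume "p \<ge> 2" "n \<ge> 1" and G: "G \<in> carrier_mat (p + q) (p + q)"
      and nonneg: "\<forall>i<p + q. \<forall>j<p + q. G $$ (i, j) \<ge> 0"
      and lam: "\<forall>i<p + q. 0 < lam i \<and> lam i \<le> lam_bar"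
      and dom: "diag_dominant (p + q) lam G \<zeta>"
      and bij: "bij_betw l {..<p + q} {1..p + q}"
      and decay: "\<forall>i<p + q. \<forall>j<p + q. G $$ (i, j) \<le> C / (1 + label_dist l i j) powr \<theta>"
    define M where "M = mat_diag (p + q) lam - G"
    define H where "H = schur_mat p M"
    define s where "s = (real n / ln (real p)) powr (1 / (2 * \<theta>))"
    have M: "M \<in> carrier_mat (p + q) (p + q)"
      using G by (simp add: M_def minus_carrier_mat)
    have entry: "M $$ (i, k) = (if i = k then lam i else 0) - G $$ (i, k)" if "i < p + q" "k < p + q" for i k
      using that G by (simp add: M_def mat_diag_def)
    have row: "(\<Sum>k<p + q. G $$ (i, k)) + \<zeta> \<le> lam i" and col: "(\<Sum>k<p + q. G $$ (k, i)) + \<zeta> \<le> lam i"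
      if "i < p + q" for i
      using dom that by (auto simp: diag_dominant_def)
    have detM: "det M \<noteq> 0"
      using nonneg by (intro dominant_mat_det_nonzero[OF M assms(3) entry _ row]) auto
    have latent: "latent_block p M \<in> carrier_mat q q"
      "\<And>i k. i < q \<Longrightarrow> k < q \<Longrightarrow> latent_block p M $$ (i, k) = M $$ (p + i, p + k)"
      using M by (auto simp: latent_block_def split_block_def Let_def add.commute)
    \<comment> \<open>Passing to a principal submatrix drops nonnegative entries from the row sums,
      so row dominance survives with the same \<open>\<zeta>\<close>.\<close>
    have detL: "det (latent_block p M) \<noteq> 0"
    proof (rule dominant_mat_det_nonzero[OF latent(1) assms(3)])
      show "latent_block p M $$ (i, k) = (if i = k then lam (p + i) else 0) - G $$ (p + i, p + k)"
        if "i < q" "k < q" for i k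
        using that by (simp add: latent entry)
      show "G $$ (p + i, p + k) \<ge> 0" if "i < q" "k < q" for i k
        using that nonneg by simp
      show "(\<Sum>k<q. G $$ (p + i, p + k)) + \<zeta> \<le> lam (p + i)" if "i < q" for i
      proof -
        have "(\<Sum>k<q. G $$ (p + i, p + k)) = (\<Sum>k\<in>(+) p ` {..<q}. G $$ (p + i, k))"
          by (simp add: sum.reindex)
        also have "\<dots> \<le> (\<Sum>k<p + q. G $$ (p + i, k))"
          using that nonneg by (intro sum_mono2) auto
        finally show ?thesis
          using row[of "p + i"] that by simp
      qed
    qed
    note invM = inv_mat_inverse[OF M detM]
    \<comment> \<open>Column \<open>j\<close> of the inverse is the solution \<open>f\<close>, its
      equations being the entries of \<open>M * inv_mat M = 1\<close> in that column; the distance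
      is \<open>label_dist l\<close>.\<close>
    have bound: "\<bar>inv_mat M $$ (i, j)\<bar> \<le> c / (1 + label_dist l i j) powr \<theta>"
      if "i < p + q" "j < p + q" for i j
      unfolding c_def
    proof (rule dominant_solution_decay[where g = "\<lambda>i k. G $$ (i, k)" and f = "\<lambda>i. inv_mat M $$ (i, j)",
          OF assms(3,2) _ rho(1,2) b(1) rho(3) _ row col _ _ _ _ _ _ that])
      fix i assume i: "i < p + q"
      have "of_bool (i = j) = (M * inv_mat M) $$ (i, j)"
        using i \<open>j < p + q\<close> by (simp add: invM)
      also have "\<dots> = (\<Sum>k<p + q. M $$ (i, k) * inv_mat M $$ (k, j))"
        using M invM(1) i \<open>j < p + q\<close> by (simp add: scalar_prod_def lessThan_atLeast0)
      also have "\<dots> = (\<Sum>k<p + q. (if i = k then lam i * inv_mat M $$ (k, j) else 0)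
          - G $$ (i, k) * inv_mat M $$ (k, j))"
        using i by (intro sum.cong) (auto simp: entry algebra_simps)
      also have "\<dots> = lam i * inv_mat M $$ (i, j) - (\<Sum>k<p + q. G $$ (i, k) * inv_mat M $$ (k, j))"
        using i by (simp add: sum_subtractf)
      finally show "lam i * inv_mat M $$ (i, j) - (\<Sum>k<p + q. G $$ (i, k) * inv_mat M $$ (k, j))
        = of_bool (i = j)" ..
    next
      show "lam i \<le> b" if "i < p + q" for i
        using lam b that by force
    qed (use assms nonneg decay in \<open>auto simp: label_dist_def\<close>)
    note schur = inv_schur_mat[OF M detM detL, folded H_def]
    have boundH: "\<bar>inv_mat H $$ (i, j)\<bar> \<le> c / (1 + label_dist l i j) powr \<theta>" if "i < p" "j < p" for i j
      using bound[of i j] schur(3)[OF that] that by simp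
    have weaken: "x \<le> c * 2 powr \<theta> / (1 + label_dist l i j) powr \<theta>"
      if "x \<le> c / (1 + label_dist l i j) powr \<theta>" for x i j
      using that divide_right_mono[OF c_le, of "(1 + label_dist l i j) powr \<theta>"] by simp
    have ln: "ln (real p) > 0"
      using \<open>p \<ge> 2\<close> by simp
    have s: "s > 0"
      using ln \<open>n \<ge> 1\<close> by (simp add: s_def)
    have inj: "inj_on l {..<p}"
      using bij by (auto simp: bij_betw_def intro: inj_on_subset)
    \<comment> \<open>The chosen \<open>s\<close> turns the truncation rate into the claimed
      one.\<close>
    have "s powr (1 - \<theta>) = (ln (real p) / real n) powr ((\<theta> - 1) / (2 * \<theta>))"
    proof -
      have "s powr (1 - \<theta>) = (real n / ln (real p)) powr (- ((\<theta> - 1) / (2 * \<theta>)))"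
        unfolding s_def by (simp add: powr_powr diff_divide_distrib)
      also have "\<dots> = (ln (real p) / real n) powr ((\<theta> - 1) / (2 * \<theta>))"
        using ln \<open>n \<ge> 1\<close> by (simp add: powr_minus powr_divide)
      finally show ?thesis .
    qed
    with band_truncation_sparse_approximation[OF schur(4) _ assms(1) s _ inj boundH] c \<open>p \<ge> 2\<close>
    have "sparse_approximation s
        (c * 2 powr \<theta> * 2 powr \<theta> / (\<theta> - 1) * (ln (real p) / real n) powr ((\<theta> - 1) / (2 * \<theta>)))
        (band_truncation l s (inv_mat H)) (inv_mat H)"
      by simp
    then show "let M = mat_diag (p + q) lam - G;
         H = schur_mat p M;
         s = (real n / ln (real p)) powr (1 / (2 * \<theta>));
         W = band_truncation l s (inv_mat H)
     in invertible_mat M \<and> invertible_mat (latent_block p M) \<and> invertible_mat H \<and>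
        (\<forall>i<p + q. \<forall>j<p + q. \<bar>inv_mat M $$ (i, j)\<bar> \<le> c * 2 powr \<theta> / (1 + label_dist l i j) powr \<theta>) \<and>
        (\<forall>i<p. \<forall>j<p. \<bar>inv_mat H $$ (i, j)\<bar> \<le> c * 2 powr \<theta> / (1 + label_dist l i j) powr \<theta>) \<and>
        (\<exists>r. sparse_approximation s r W (inv_mat H) \<and>
             r \<le> c * 2 powr \<theta> * 2 powr \<theta> / (\<theta> - 1) * (ln (real p) / real n) powr ((\<theta> - 1) / (2 * \<theta>)))"
      using invM(4) inv_mat_inverse(4)[OF latent(1) detL] schur(2) weaken[OF bound] weaken[OF boundH]
      unfolding Let_def M_def[symmetric] H_def[symmetric] s_def[symmetric] by auto
  qed
qed

end
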